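(* (Triangular floor.) Let $u>0$ and $1<\alpha<e^{2u}$. For $-u<\tau<u$, $\chi\in\mathbb R$ let $S_{\tau,\chi}$ be the function on $\mathbb C\setminus\mathbb R$ defined in the context, associated with the scaling limit of skew plane partitions with 2-periodic weights and triangular floor. Then the disordered region $$\{(\tau,\chi)\in(-u,u)\times\mathbb R:\ S_{\tau,\chi}\text{ has a pair of non-real complex conjugate critical points}\}$$ is a bounded subset of $\mathbb R^2$.
   Context: Let $V(\tau)=-\frac12|\tau+u|-\frac12|\tau-u|$ (the rescaled staircase back wall, equal to $-u$ for $|\tau|\le u$). For $z\in\mathbb C\setminus\mathbb R$ and $-u<\tau<u$, with principal branches of the logarithm, $$S_{\tau,\chi}(z)=\tfrac12\int_{-u}^{\tau}\ln\big(1-e^{M}\alpha^{-\frac12}z^{-1}\big)\,dM-\tfrac12\int_{\tau}^{u}\ln\big(1-e^{-M}\alpha^{-\frac12}z\big)\,dM-\big(\chi-\tfrac12V(\tau)\big)\ln z .$$ A non-real critical point of $S_{\tau,\chi}$ is a point $z\in\mathbb C\setminus\mathbb R$ with $S_{\tau,\chi}'(z)=0$. *)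

theory Defs
  imports "HOL-Analysis.Analysis"
begin

definition back_wall :: "real \<Rightarrow> real \<Rightarrow> real" where
  "back_wall u \<tau> = - (1/2) * \<bar>\<tau> + u\<bar> - (1/2) * \<bar>\<tau> - u\<bar>"

text \<open>The complex \<^const>\<open>ln\<close> is the principal branch. The values of \<open>S_fun\<close> are
  meaningful only for \<open>z \<notin> \<real>\<close>, where the arguments of all three logarithms are non-real
  and both integrands are continuous in \<open>M\<close>.\<close>

definition S_fun :: "real \<Rightarrow> real \<Rightarrow> real \<Rightarrow> real \<Rightarrow> complex \<Rightarrow> complex" where
  "S_fun u \<alpha> \<tau> chi z =
     1/2 * integral {-u..\<tau>} (\<lambda>M. ln (1 - of_real (exp M * \<alpha> powr (-1/2)) * inverse z))
   - 1/2 * integral {\<tau>..u} (\<lambda>M. ln (1 - of_real (exp (-M) * \<alpha> powr (-1/2)) * z))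
   - of_real (chi - 1/2 * back_wall u \<tau>) * ln z"

text \<open>Since the non-reals are open, the two-sided derivative at a non-real point does not
  depend on the values of \<open>f\<close> on the real axis.\<close>

definition nonreal_critical_point :: "(complex \<Rightarrow> complex) \<Rightarrow> complex \<Rightarrow> bool" where
  "nonreal_critical_point f z \<longleftrightarrow> z \<notin> \<real> \<and> (f has_field_derivative 0) (at z)"

definition disordered_region :: "real \<Rightarrow> real \<Rightarrow> (real \<times> real) set" where
  "disordered_region u \<alpha> =
     {(\<tau>, chi). -u < \<tau> \<and> \<tau> < u \<and>
        (\<exists>z. nonreal_critical_point (S_fun u \<alpha> \<tau> chi) z \<and>
             nonreal_critical_point (S_fun u \<alpha> \<tau> chi) (cnj z))}"

end

theory Submission
  imports Defs
begin

text \<open>With \<open>a = \<alpha> powr (-1/2)\<close>, the equation \<open>S'(z) = 0\<close> reads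
  \<open>log (z - a e^(-u)) - log (z - a e^\<tau>) + log (1 - a e^(-u) z) - log (1 - a e^(-\<tau>) z) = 2 \<chi> + u\<close>.
  Exponentiating, \<open>z\<close> is a root of the real quadratic
  \<open>(z - a e^(-u)) (1 - a e^(-u) z) = c (z - a e^\<tau>) (1 - a e^(-\<tau>) z)\<close> with \<open>c = e^(2 \<chi> + u)\<close>.
  If \<open>z\<close> is non-real its discriminant is nonpositive, and since \<open>a < 1\<close> and \<open>a e^(-u) < 1\<close> this
  keeps \<open>c\<close> between two positive constants that do not depend on \<open>\<tau>\<close>.\<close>

section \<open>Non-real numbers and differentiation under the integral sign\<close>

lemma one_minus_real_mult_notin_Reals:
  fixes z :: complex and r :: real
  assumes "z \<notin> \<real>" "r \<noteq> 0"
  shows "1 - of_real r * z \<notin> \<real>"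
  using assms by (auto simp: complex_is_Real_iff)

lemma inverse_notin_Reals:
  fixes z :: complex
  assumes "z \<notin> \<real>"
  shows "inverse z \<notin> \<real>"
  using assms Reals_inverse[of "inverse z"] by auto

lemma Reals_if_nonpos_Reals: "z \<in> \<real>\<^sub>\<le>\<^sub>0 \<Longrightarrow> z \<in> \<real>"
  by (auto elim: nonpos_Reals_cases)

text \<open>The open upper or lower half-plane through \<open>z\<close> works. Since
  \<open>inner (\<i> * of_real (Im z)) w\<close> equals \<open>Im z * Im w\<close>, one half-space
  formula covers both signs of \<open>Im z\<close>.\<close>

lemma nonreal_convex_neighbourhood:
  fixes z :: complex
  assumes "z \<notin> \<real>"
  obtains U where "open U" "convex U" "z \<in> U" "\<And>w. w \<in> U \<Longrightarrow> w \<notin> \<real>"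
proof -
  define U where "U = {w. 0 < inner (\<i> * of_real (Im z)) w}"
  have "open U" "convex U"
    unfolding U_def by (rule open_halfspace_gt, rule convex_halfspace_gt)
  moreover have "z \<in> U" "\<And>w. w \<in> U \<Longrightarrow> w \<notin> \<real>"
    using assms by (auto simp: U_def inner_complex_def complex_is_Real_iff zero_less_mult_iff)
  ultimately show ?thesis using that by blast
qed

text \<open>The Leibniz rule works on a convex set, and the non-reals are not convex. It is
  therefore applied on the half-plane around \<open>z\<close>, whose openness turns the derivative
  within it into a two-sided one.\<close>

lemma has_field_derivative_integral_nonreal:
  fixes f fz :: "complex \<Rightarrow> real \<Rightarrow> complex"
  assumes z: "z \<notin> \<real>"
    and deriv: "\<And>w M. w \<notin> \<real> \<Longrightarrow> ((\<lambda>w. f w M) has_field_derivative fz w M) (at w)"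
    and cont: "\<And>w. w \<notin> \<real> \<Longrightarrow> continuous_on {s..t} (f w)"
    and cont': "continuous_on ((- \<real>) \<times> {s..t}) (\<lambda>(w, M). fz w M)"
  shows "((\<lambda>w. integral {s..t} (f w)) has_field_derivative integral {s..t} (fz z)) (at z)"
proof -
  obtain U where U: "open U" "convex U" "z \<in> U" "\<And>w. w \<in> U \<Longrightarrow> w \<notin> \<real>"
    using nonreal_convex_neighbourhood[OF z] by metis
  have "((\<lambda>w. integral (cbox s t) (f w)) has_field_derivative integral (cbox s t) (fz z))
      (at z within U)"
  proof (rule leibniz_rule_field_derivative)
    show "continuous_on (U \<times> cbox s t) (\<lambda>(w, M). fz w M)"
      by (rule continuous_on_subset[OF cont']) (use U in auto)
    show "f w integrable_on cbox s t" if "w \<in> U" for w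
      using cont[OF U(4)[OF that]] by (simp add: integrable_continuous_real)
    show "((\<lambda>w. f w M) has_field_derivative fz w M) (at w within U)"
      if "w \<in> U" "M \<in> cbox s t" for w M
      using deriv[OF U(4)[OF that(1)]] by (rule has_field_derivative_at_within)
  qed (fact U(3), fact U(2))
  then show ?thesis
    by (simp add: at_within_open[OF U(3,1)])
qed

section \<open>Closed derivatives of the two logarithmic integrals\<close>

lemma has_field_derivative_ln_one_minus_inverse:
  fixes w r :: complex
  assumes "1 - r * inverse w \<notin> \<real>\<^sub>\<le>\<^sub>0" "w \<noteq> 0" "w - r \<noteq> 0"
  shows "((\<lambda>w. ln (1 - r * inverse w)) has_field_derivative r / (w * (w - r))) (at w)"
proof -
  have "((\<lambda>w. ln (1 - r * inverse w)) has_field_derivative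
      inverse (1 - r * inverse w) * (r * (inverse w * inverse w))) (at w)"
    using assms by (auto intro!: derivative_eq_intros)
  also have "inverse (1 - r * inverse w) * (r * (inverse w * inverse w)) = r / (w * (w - r))"
    using assms by (simp add: divide_simps)
  finally show ?thesis .
qed

lemma has_field_derivative_ln_one_minus_mult:
  fixes w r :: complex
  assumes "1 - r * w \<notin> \<real>\<^sub>\<le>\<^sub>0"
  shows "((\<lambda>w. ln (1 - r * w)) has_field_derivative - r / (1 - r * w)) (at w)"
  using assms by (auto intro!: derivative_eq_intros simp: divide_inverse)

text \<open>The \<open>w\<close>-derivative of the integrand, taken at \<open>z\<close>, has the
  elementary antiderivative \<open>- ln (z - a * exp M) / z\<close> in \<open>M\<close>. Its
  argument keeps the imaginary part of \<open>z\<close>, so it never meets the branch cut.\<close>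

lemma has_field_derivative_integral_left:
  fixes z :: complex and a :: real
  assumes z: "z \<notin> \<real>" and a: "a > 0" and st: "s \<le> t"
  shows "((\<lambda>w. integral {s..t} (\<lambda>M. ln (1 - of_real (exp M * a) * inverse w)))
    has_field_derivative (ln (z - of_real (a * exp s)) - ln (z - of_real (a * exp t))) / z) (at z)"
proof -
  define fz where "fz w M = of_real (exp M * a) / (w * (w - of_real (exp M * a)))"
    for w :: complex and M :: real
  have arg: "1 - of_real (exp M * a) * inverse w \<notin> \<real>\<^sub>\<le>\<^sub>0" if "w \<notin> \<real>" for w :: complex and M
    using one_minus_real_mult_notin_Reals[OF inverse_notin_Reals[OF that], of "exp M * a"] a
      Reals_if_nonpos_Reals by auto
  have nz: "w \<noteq> 0" "w - of_real r \<noteq> 0" "w - of_real r \<notin> \<real>\<^sub>\<le>\<^sub>0"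
    if "w \<notin> \<real>" for w :: complex and r
    using that by (auto simp: complex_is_Real_iff complex_eq_iff complex_nonpos_Reals_iff)
  have "((\<lambda>w. integral {s..t} (\<lambda>M. ln (1 - of_real (exp M * a) * inverse w)))
      has_field_derivative integral {s..t} (fz z)) (at z)"
  proof (rule has_field_derivative_integral_nonreal[OF z])
    show "((\<lambda>w. ln (1 - of_real (exp M * a) * inverse w)) has_field_derivative fz w M) (at w)"
      if w: "w \<notin> \<real>" for w M
      unfolding fz_def
      by (rule has_field_derivative_ln_one_minus_inverse[OF arg[OF w] nz(1)[OF w] nz(2)[OF w]])
    show "continuous_on {s..t} (\<lambda>M. ln (1 - of_real (exp M * a) * inverse w))"
      if "w \<notin> \<real>" for w :: complex
      using arg[OF that] by (intro continuous_intros) auto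
    show "continuous_on ((- \<real>) \<times> {s..t}) (\<lambda>(w, M). fz w M)"
      using nz unfolding fz_def split_def
      by (intro continuous_intros) (auto simp del: of_real_mult)
  qed
  moreover have "(fz z has_integral
      - ln (z - of_real (a * exp t)) / z - (- ln (z - of_real (a * exp s)) / z)) {s..t}"
  proof (rule fundamental_theorem_of_calculus[OF st])
    fix M
    have "((\<lambda>M. - ln (z - of_real (a * exp M)) / z) has_vector_derivative fz z M) (at M)"
    proof -
      \<comment> \<open>The antiderivative is holomorphic in \<open>x\<close> near
        \<open>exp M\<close>; the chain rule along the real curve \<open>x = exp M\<close> supplies
        the missing factor \<open>exp M\<close>.\<close>
      have "((\<lambda>x. - ln (z - a * x) / z) has_field_derivative a / (z * (z - a * exp M)))
          (at (of_real (exp M)))"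
        using nz(1)[OF z] nz(2)[OF z, of "a * exp M"] nz(3)[OF z, of "a * exp M"]
        by (auto intro!: derivative_eq_intros simp: divide_simps)
      moreover have "((\<lambda>M. of_real (exp M) :: complex) has_vector_derivative of_real (exp M)) (at M)"
        by (auto intro!: derivative_eq_intros has_vector_derivative_of_real
            simp: has_real_derivative_iff_has_vector_derivative [symmetric])
      ultimately have "((\<lambda>x. - ln (z - a * x) / z) \<circ> (\<lambda>M. complex_of_real (exp M))
          has_vector_derivative
          of_real (exp M) * (a / (z * (z - a * exp M)))) (at M)"
        by (rule field_vector_diff_chain_at[rotated])
      then show ?thesis by (simp add: o_def fz_def algebra_simps)
    qed
    then show "((\<lambda>M. - ln (z - of_real (a * exp M)) / z) has_vector_derivative fz z M)
        (at M within {s..t})"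
      by (rule has_vector_derivative_at_within)
  qed
  ultimately show ?thesis
    by (simp add: integral_unique diff_divide_distrib)
qed

text \<open>The same argument applies with the antiderivative
  \<open>- ln (1 - a * exp (- M) * z) / z\<close>, composed with the curve
  \<open>x = exp (- M)\<close>.\<close>

lemma has_field_derivative_integral_right:
  fixes z :: complex and a :: real
  assumes z: "z \<notin> \<real>" and a: "a > 0" and st: "s \<le> t"
  shows "((\<lambda>w. integral {s..t} (\<lambda>M. ln (1 - of_real (exp (- M) * a) * w)))
    has_field_derivative
      (ln (1 - of_real (a * exp (- s)) * z) - ln (1 - of_real (a * exp (- t)) * z)) / z) (at z)"
proof -
  define fz where "fz w M = - of_real (exp (- M) * a) / (1 - of_real (exp (- M) * a) * w)"
    for w :: complex and M :: real
  have arg: "1 - of_real (exp (- M) * a) * w \<notin> \<real>\<^sub>\<le>\<^sub>0" if "w \<notin> \<real>" for w :: complex and M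
    using one_minus_real_mult_notin_Reals[OF that, of "exp (- M) * a"] a
      Reals_if_nonpos_Reals by auto
  have nz: "1 - of_real (exp (- M) * a) * w \<noteq> 0" if "w \<notin> \<real>" for w :: complex and M
    using arg[OF that, of M] by auto
  have z0: "z \<noteq> 0" using z by auto
  have "((\<lambda>w. integral {s..t} (\<lambda>M. ln (1 - of_real (exp (- M) * a) * w)))
      has_field_derivative integral {s..t} (fz z)) (at z)"
  proof (rule has_field_derivative_integral_nonreal[OF z])
    show "((\<lambda>w. ln (1 - of_real (exp (- M) * a) * w)) has_field_derivative fz w M) (at w)"
      if w: "w \<notin> \<real>" for w M
      unfolding fz_def using arg[OF w] by (rule has_field_derivative_ln_one_minus_mult)
    show "continuous_on {s..t} (\<lambda>M. ln (1 - of_real (exp (- M) * a) * w))"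
      if "w \<notin> \<real>" for w :: complex
      using arg[OF that] by (intro continuous_intros) auto
    show "continuous_on ((- \<real>) \<times> {s..t}) (\<lambda>(w, M). fz w M)"
      using nz unfolding fz_def split_def
      by (intro continuous_intros) (auto simp del: of_real_mult)
  qed
  moreover have "(fz z has_integral
      - ln (1 - of_real (a * exp (- t)) * z) / z
      - (- ln (1 - of_real (a * exp (- s)) * z) / z)) {s..t}"
  proof (rule fundamental_theorem_of_calculus[OF st])
    fix M
    have "((\<lambda>M. - ln (1 - of_real (a * exp (- M)) * z) / z) has_vector_derivative fz z M)
        (at M)"
    proof -
      have "((\<lambda>x. - ln (1 - a * x * z) / z) has_field_derivative a / (1 - a * exp (- M) * z))
          (at (of_real (exp (- M))))"
      proof (rule DERIV_cong)
        show "((\<lambda>x. - ln (1 - a * x * z) / z) has_field_derivative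
            - (- (a * z) / (1 - (a * z) * exp (- M))) / z) (at (of_real (exp (- M))))"
          using arg[OF z, of M] has_field_derivative_ln_one_minus_mult[of "a * z" "exp (- M)"]
          by (intro DERIV_cdivide DERIV_minus) (simp add: mult_ac)
        have "- (- (a * z) / k) / z = a / k" for k :: complex
          using z0 by simp
        then show "- (- (a * z) / (1 - (a * z) * exp (- M))) / z = a / (1 - a * exp (- M) * z)"
          by (simp add: mult_ac)
      qed
      moreover have "((\<lambda>M. of_real (exp (- M)) :: complex) has_vector_derivative
          of_real (- exp (- M))) (at M)"
        by (auto intro!: derivative_eq_intros has_vector_derivative_of_real
            simp: has_real_derivative_iff_has_vector_derivative [symmetric])
      ultimately have "((\<lambda>x. - ln (1 - a * x * z) / z) \<circ> (\<lambda>M. complex_of_real (exp (- M)))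
          has_vector_derivative of_real (- exp (- M)) * (a / (1 - a * exp (- M) * z))) (at M)"
        by (rule field_vector_diff_chain_at[rotated])
      then show ?thesis by (simp add: o_def fz_def algebra_simps)
    qed
    then show "((\<lambda>M. - ln (1 - of_real (a * exp (- M)) * z) / z) has_vector_derivative fz z M)
        (at M within {s..t})"
      by (rule has_vector_derivative_at_within)
  qed
  ultimately show ?thesis
    by (simp add: integral_unique diff_divide_distrib)
qed

section \<open>From critical points to a real quadratic and its discriminant\<close>

text \<open>Splitting the equation into real and imaginary parts and cancelling \<open>y\<close>
  gives \<open>4 * p * r - q^2 = (2 * p * y)^2\<close>. Nothing is divided by \<open>p\<close>, so
  the degenerate case \<open>p = 0\<close> is included.\<close>

lemma nonreal_root_discriminant:
  fixes z :: complex and p q r :: real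
  assumes z: "z \<notin> \<real>" and root: "of_real p * z\<^sup>2 + of_real q * z + of_real r = 0"
  shows "q\<^sup>2 \<le> 4 * p * r"
proof -
  define x y where "x = Re z" and "y = Im z"
  have y: "y \<noteq> 0" using z by (simp add: y_def complex_is_Real_iff)
  have "p * (x\<^sup>2 - y\<^sup>2) + q * x + r = 0" "p * (2 * x * y) + q * y = 0"
    using root by (simp_all add: complex_eq_iff x_def y_def power2_eq_square algebra_simps)
  moreover from this have q: "q = - 2 * p * x"
    using y by algebra
  ultimately have "r = p * (x\<^sup>2 + y\<^sup>2)"
    by algebra
  with q have "4 * p * r - q\<^sup>2 = (2 * p * y)\<^sup>2"
    by (simp add: power2_eq_square algebra_simps)
  then show ?thesis using zero_le_power2[of "2 * p * y"] by linarith
qed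

text \<open>The logarithmic equation is only exponentiated, never solved for a logarithm, so sums of
  principal logarithms cause no branch ambiguity.\<close>

lemma critical_point_quadratic:
  assumes \<tau>: "-u < \<tau>" "\<tau> < u" and \<alpha>: "\<alpha> > 0"
    and crit: "nonreal_critical_point (S_fun u \<alpha> \<tau> chi) z"
  defines "a \<equiv> \<alpha> powr (-1/2)"
  shows "(z - of_real (a * exp (-u))) * (1 - of_real (a * exp (-u)) * z) =
    of_real (exp (2 * chi + u)) * ((z - of_real (a * exp \<tau>)) * (1 - of_real (a * exp (-\<tau>)) * z))"
proof -
  have z: "z \<notin> \<real>" and S0: "(S_fun u \<alpha> \<tau> chi has_field_derivative 0) (at z)"
    using crit by (auto simp: nonreal_critical_point_def)
  have a: "a > 0" using \<alpha> by (simp add: a_def)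
  have z0: "z \<noteq> 0" "z \<notin> \<real>\<^sub>\<le>\<^sub>0" using z Reals_if_nonpos_Reals by auto
  have n1: "z - of_real r \<noteq> 0" for r using z by auto
  have n2: "1 - of_real (a * exp r) * z \<noteq> 0" for r
    using one_minus_real_mult_notin_Reals[OF z, of "a * exp r"] a
    by (metis Reals_0 exp_not_eq_zero less_irrefl mult_eq_0_iff)
  define A B C D where "A = z - of_real (a * exp (-u))" and "B = z - of_real (a * exp \<tau>)"
    and "C = 1 - of_real (a * exp (-\<tau>)) * z" and "D = 1 - of_real (a * exp (-u)) * z"
  have nz: "A \<noteq> 0" "B \<noteq> 0" "C \<noteq> 0" "D \<noteq> 0"
    unfolding A_def B_def C_def D_def using n1 n2 by blast+
  \<comment> \<open>The flat wall makes the coefficient of \<open>ln z\<close> equal to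
    \<open>- (chi + u/2)\<close>; doubled, it yields the exponent
    \<open>2 * chi + u\<close>.\<close>
  have wall: "back_wall u \<tau> = - u" using \<tau> by (simp add: back_wall_def field_simps)
  have "(S_fun u \<alpha> \<tau> chi has_field_derivative
      1/2 * ((ln A - ln B) / z) - 1/2 * ((ln C - ln D) / z)
      - of_real (chi - 1/2 * back_wall u \<tau>) * inverse z) (at z)"
    unfolding S_fun_def[abs_def] a_def[symmetric] A_def B_def C_def D_def
    using \<tau> z0
    by (intro DERIV_diff DERIV_cmult has_field_derivative_integral_left[OF z a]
        has_field_derivative_integral_right[OF z a] has_field_derivative_Ln) auto
  note D0 = DERIV_unique[OF this S0]
  \<comment> \<open>Multiplying the derivative by \<open>2 * z\<close> clears all
    denominators.\<close>
  have "(ln A + ln D) - (of_real (2 * chi + u) + (ln B + ln C)) =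
      2 * z * (1/2 * ((ln A - ln B) / z) - 1/2 * ((ln C - ln D) / z)
        - of_real (chi - 1/2 * back_wall u \<tau>) * inverse z)"
    using z0(1) by (simp add: wall field_simps)
  then have "ln A + ln D = of_real (2 * chi + u) + (ln B + ln C)"
    unfolding D0 by simp
  then have "exp (ln A + ln D) = exp (of_real (2 * chi + u) + (ln B + ln C))" by simp
  then have "A * D = of_real (exp (2 * chi + u)) * (B * C)"
    using nz unfolding exp_add[of "ln _"] exp_add[of "of_real _"] exp_of_real by simp
  then show ?thesis by (simp add: A_def B_def C_def D_def)
qed

text \<open>The discriminant inequality is weakened until \<open>\<tau>\<close> disappears, leaving
  a bound on \<open>\<bar>q\<bar>\<close> that is linear in \<open>c\<close>. Its two signs give the
  two estimates.\<close>

lemma critical_point_bounds: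
  assumes \<alpha>: "\<alpha> > 1" and \<tau>: "-u < \<tau>" "\<tau> < u"
    and crit: "nonreal_critical_point (S_fun u \<alpha> \<tau> chi) z"
  defines "a \<equiv> \<alpha> powr (-1/2)"
  shows "(1 - a * exp (-u))\<^sup>2 \<le> exp (2 * chi + u) * (1 + a)\<^sup>2"
    and "exp (2 * chi + u) * (1 - a)\<^sup>2 \<le> (1 + a * exp (-u))\<^sup>2"
proof -
  define K where "K = a * exp (-u)"
  define c where "c = exp (2 * chi + u)"
  have pos: "c > 0" "a > 0" "K > 0" using \<alpha> by (auto simp: c_def a_def K_def)
  define p q r where "p = a * exp (-\<tau>) * c - K" and "q = 1 + K\<^sup>2 - c * (1 + a\<^sup>2)"
    and "r = a * exp \<tau> * c - K"
  have E: "a * exp \<tau> * (a * exp (-\<tau>)) = a\<^sup>2"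
    by (simp add: exp_minus power2_eq_square)
  have E': "of_real (a * exp \<tau>) * of_real (a * exp (-\<tau>)) = (of_real (a\<^sup>2) :: complex)"
    unfolding of_real_mult[symmetric] E ..
  \<comment> \<open>Stated for free complex variables, so that \<open>algebra\<close> needs only the
    product \<open>b1 * b2\<close>, which is where \<open>\<tau>\<close> cancels.\<close>
  have expand: "(b2 * c - k) * z\<^sup>2 + (1 + k\<^sup>2 - c * (1 + d)) * z + (b1 * c - k) = 0"
    if "(z - k) * (1 - k * z) = c * ((z - b1) * (1 - b2 * z))" "b1 * b2 = d"
    for b1 b2 c d k :: complex
    using that by algebra
  have "(z - of_real K) * (1 - of_real K * z) =
      of_real c * ((z - of_real (a * exp \<tau>)) * (1 - of_real (a * exp (-\<tau>)) * z))"
    using critical_point_quadratic[OF \<tau> _ crit] \<alpha> by (simp add: K_def c_def a_def)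
  then have "of_real p * z\<^sup>2 + of_real q * z + of_real r = 0"
    using expand[OF _ E'] unfolding p_def q_def r_def by simp
  then have "q\<^sup>2 \<le> 4 * p * r"
    using crit by (intro nonreal_root_discriminant) (auto simp: nonreal_critical_point_def)
  also have "4 * p * r \<le> (2 * a * c)\<^sup>2 + (2 * K)\<^sup>2"
  proof -
    have "p * r = a\<^sup>2 * c\<^sup>2 + K\<^sup>2 - K * a * c * (exp \<tau> + exp (-\<tau>))"
      unfolding p_def r_def using E by algebra
    moreover have "0 \<le> K * a * c * (exp \<tau> + exp (-\<tau>))"
      using pos by (simp add: add_nonneg_nonneg)
    ultimately have "p * r \<le> a\<^sup>2 * c\<^sup>2 + K\<^sup>2" by linarith
    then show ?thesis by (simp add: power_mult_distrib)
  qed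
  also have "\<dots> \<le> (2 * a * c + 2 * K)\<^sup>2"
    using pos by (simp add: power2_sum)
  finally have "\<bar>q\<bar> \<le> 2 * a * c + 2 * K"
    using pos by (simp add: abs_le_square_iff[symmetric])
  \<comment> \<open>Moving \<open>2 * a * c\<close> and \<open>2 * K\<close> to the sides of
    \<open>c * (1 + a^2)\<close> and \<open>1 + K^2\<close> completes all four squares.\<close>
  then have "(1 - K)\<^sup>2 \<le> c * (1 + a)\<^sup>2" "c * (1 - a)\<^sup>2 \<le> (1 + K)\<^sup>2"
    unfolding q_def by (auto simp: power2_eq_square algebra_simps)
  then show "(1 - a * exp (-u))\<^sup>2 \<le> exp (2 * chi + u) * (1 + a)\<^sup>2"
    "exp (2 * chi + u) * (1 - a)\<^sup>2 \<le> (1 + a * exp (-u))\<^sup>2"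
    by (simp_all add: K_def c_def)
qed

theorem mainTheorem5:
  fixes u \<alpha> :: real
  assumes "u > 0" and "1 < \<alpha>" and "\<alpha> < exp (2 * u)"
  shows "bounded (disordered_region u \<alpha>)"
proof -
  define a where "a = \<alpha> powr (-1/2)"
  define K where "K = a * exp (-u)"
  \<comment> \<open>\<open>l\<close> and \<open>h\<close> are the resulting bounds for
    \<open>exp (2 * chi + u)\<close>. From \<open>\<alpha> > 1\<close> comes \<open>a < 1\<close>,
    which keeps the denominator of \<open>h\<close> nonzero; with \<open>u > 0\<close> it gives
    \<open>K < 1\<close>, hence \<open>l > 0\<close> and \<open>ln l\<close> is meaningful.\<close>
  define l where "l = (1 - K)\<^sup>2 / (1 + a)\<^sup>2"
  define h where "h = (1 + K)\<^sup>2 / (1 - a)\<^sup>2"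
  have a: "0 < a" "a < 1"
    using assms by (auto simp: a_def powr_less_one)
  have K: "0 < K" "K < 1"
    using a assms mult_strict_mono[of a 1 "exp (-u)" 1] by (auto simp: K_def)
  have pos: "l > 0" "h > 0" using a K by (auto simp: l_def h_def)
  have "disordered_region u \<alpha> \<subseteq> {-u..u} \<times> {(ln l - u) / 2 .. (ln h - u) / 2}"
  proof
    fix x assume "x \<in> disordered_region u \<alpha>"
    then obtain \<tau> chi z where x: "x = (\<tau>, chi)" and \<tau>: "-u < \<tau>" "\<tau> < u"
      and crit: "nonreal_critical_point (S_fun u \<alpha> \<tau> chi) z"
      by (auto simp: disordered_region_def)
    have "l \<le> exp (2 * chi + u)" "exp (2 * chi + u) \<le> h"
      using critical_point_bounds[OF assms(2) \<tau> crit, folded a_def, folded K_def] a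
      by (simp_all add: l_def h_def pos_divide_le_eq pos_le_divide_eq)
    then have "ln l \<le> 2 * chi + u" "2 * chi + u \<le> ln h"
      using pos by (metis ln_exp ln_le_cancel_iff exp_gt_zero)+
    then show "x \<in> {-u..u} \<times> {(ln l - u) / 2 .. (ln h - u) / 2}"
      using \<tau> by (simp add: x field_simps)
  qed
  then show ?thesis
    by (rule bounded_subset[rotated]) (intro bounded_Times bounded_closed_interval)
qed

end
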